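(* Fix $K,r\in[1,\infty)$, and let $f_i:\mathbb R\to\mathbb R$, $i\in\mathbb N_0=\{0,1,2,\dots\}$, be $K$-Lipschitz continuous with $|f_i(0)|\le K$. Define $g_d:\mathbb R^d\to\mathbb R$ by $g_d(x)=f_0\big(\sum_{i=1}^d f_i(x_i)\big)$. Then for all $d\in\mathbb N$ and $\varepsilon\in(0,1]$, there exists $\phi\in\mathcal N$ with $\mathcal R_{\mathrm{ReLU}}^\phi\in C(\mathbb R^d,\mathbb R)$ such that 1) $\sup_{x\in[-r,r]^d}|g_d(x)-\mathcal R_{\mathrm{ReLU}}^\phi(x)|\le\varepsilon$, 2) $\mathcal R_{\mathrm{ReLU}}^\phi$ is $\sqrt d\,K^2$-Lipschitz continuous on $\mathbb R^d$, and 3) $\mathcal P(\phi)\le\tfrac56\,10^3\,K^4\,r\,d^6\,\varepsilon^{-1}$.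
   Context: $\mathbb N=\{1,2,\dots\}$; Lipschitz continuity is with respect to the Euclidean norm. A skeleton is $\phi=[(V_1,b_1),\dots,(V_D,b_D)]$ with $D\in\mathbb N$, $l_0,\dots,l_D\in\mathbb N$, $V_k\in\mathbb R^{l_k\times l_{k-1}}$, $b_k\in\mathbb R^{l_k}$. $\mathcal N$ is the set of all skeletons, and the number of parameters is $\mathcal P(\phi)=\sum_{k=1}^D l_k(l_{k-1}+1)$. With $\mathrm{ReLU}(x)=\max\{x,0\}$ applied componentwise, the ReLU-realization is $\mathcal R_{\mathrm{ReLU}}^\phi=A_D\circ\mathrm{ReLU}\circ A_{D-1}\circ\cdots\circ\mathrm{ReLU}\circ A_1\in C(\mathbb R^{l_0},\mathbb R^{l_D})$ with $A_k(x)=V_kx+b_k$. *)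

theory Defs
  imports
    "HOL-Analysis.Abstract_Metric_Spaces"
    "HOL-Analysis.L2_Norm"
    "HOL-Analysis.Lipschitz"
    "HOL-Library.Extended_Real"
    "Jordan_Normal_Form.Matrix"
begin

text \<open>\<open>\<real>\<^sup>n\<close> is \<open>carrier_vec n\<close>. Vector indices start at \<open>0\<close>, so the \<open>i\<close>-th coordinate (\<open>1 \<le> i \<le> n\<close>)
  of \<open>x\<close> is \<open>x $ (i - 1)\<close>.\<close>

definition eucl_dist :: "nat \<Rightarrow> real vec \<Rightarrow> real vec \<Rightarrow> real" where
  "eucl_dist n x y = L2_set (\<lambda>i. x $ i - y $ i) {..<n}"

lemma Metric_space_eucl: "Metric_space (carrier_vec n) (eucl_dist n)"
proof
  fix x y z :: "real vec"
  show "0 \<le> eucl_dist n x y" by (simp add: eucl_dist_def)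
  show "eucl_dist n x y = eucl_dist n y x"
    by (simp add: eucl_dist_def L2_set_def power2_commute)
  show "eucl_dist n x y = 0 \<longleftrightarrow> x = y" if "x \<in> carrier_vec n" "y \<in> carrier_vec n"
    using that by (auto simp: eucl_dist_def L2_set_eq_0_iff)
  show "eucl_dist n x z \<le> eucl_dist n x y + eucl_dist n y z"
    using L2_set_triangle_ineq[of "\<lambda>i. x $ i - y $ i" "\<lambda>i. y $ i - z $ i" "{..<n}"]
    by (simp add: eucl_dist_def)
qed

definition eucl_topology :: "nat \<Rightarrow> real vec topology" where
  "eucl_topology n = Metric_space.mtopology (carrier_vec n) (eucl_dist n)"

text \<open>The following two notions concern a map \<open>\<real>\<^sup>m \<rightarrow> \<real>\<^sup>n\<close>; its values outside \<open>carrier_vec m\<close>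
  are irrelevant.\<close>

definition continuous_maps :: "nat \<Rightarrow> nat \<Rightarrow> (real vec \<Rightarrow> real vec) set" where
  "continuous_maps m n = {F. continuous_map (eucl_topology m) (eucl_topology n) F}"

definition lipschitz_map :: "real \<Rightarrow> nat \<Rightarrow> nat \<Rightarrow> (real vec \<Rightarrow> real vec) \<Rightarrow> bool" where
  "lipschitz_map L m n F \<longleftrightarrow>
     0 \<le> L \<and> F \<in> carrier_vec m \<rightarrow> carrier_vec n \<and>
     (\<forall>x\<in>carrier_vec m. \<forall>y\<in>carrier_vec m. eucl_dist n (F x) (F y) \<le> L * eucl_dist m x y)"

text \<open>The list \<open>[(V\<^sub>1, b\<^sub>1), \<dots>, (V\<^sub>D, b\<^sub>D)]\<close>; the entry at list index \<open>k - 1\<close> is \<open>(V\<^sub>k, b\<^sub>k)\<close>.\<close>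

type_synonym layers = "(real mat \<times> real vec) list"

text \<open>The layer dimensions \<open>l\<^sub>0, \<dots>, l\<^sub>D\<close>.\<close>

definition layer_dim :: "layers \<Rightarrow> nat \<Rightarrow> nat" where
  "layer_dim \<phi> k = (if k = 0 then dim_col (fst (\<phi> ! 0)) else dim_row (fst (\<phi> ! (k - 1))))"

definition skeletons :: "layers set" where
  "skeletons = {\<phi>. length \<phi> \<ge> 1 \<and> (\<forall>k\<in>{0..length \<phi>}. layer_dim \<phi> k \<ge> 1) \<and>
     (\<forall>k\<in>{1..length \<phi>}.
        fst (\<phi> ! (k - 1)) \<in> carrier_mat (layer_dim \<phi> k) (layer_dim \<phi> (k - 1)) \<and>
        snd (\<phi> ! (k - 1)) \<in> carrier_vec (layer_dim \<phi> k))}"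

definition num_params :: "layers \<Rightarrow> nat" where
  "num_params \<phi> = (\<Sum>k = 1..length \<phi>. layer_dim \<phi> k * (layer_dim \<phi> (k - 1) + 1))"

definition ReLU :: "real \<Rightarrow> real" where
  "ReLU x = max x 0"

definition affine :: "real mat \<times> real vec \<Rightarrow> real vec \<Rightarrow> real vec" where
  "affine A x = fst A *\<^sub>v x + snd A"

text \<open>The equation for the empty list is a dummy: the empty list is not a skeleton.\<close>

fun realization :: "layers \<Rightarrow> real vec \<Rightarrow> real vec" where
  "realization [] = id"
| "realization [A] = affine A"
| "realization (A # B # \<phi>) = realization (B # \<phi>) \<circ> map_vec ReLU \<circ> affine A"

definition cube :: "nat \<Rightarrow> real \<Rightarrow> real vec set" where
  "cube d r = {x \<in> carrier_vec d. \<forall>i<d. x $ i \<in> {-r..r}}"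

definition gfun :: "(nat \<Rightarrow> real \<Rightarrow> real) \<Rightarrow> nat \<Rightarrow> real vec \<Rightarrow> real" where
  "gfun f d x = f 0 (\<Sum>i = 1..d. f i (x $ (i - 1)))"

end

(* Replace each f_i by its piecewise linear interpolant p_i on an equidistant grid of step h,
   continued by constants. It is again K-Lipschitz, its error is at most 2 K h, and it is a
   sum of O(1/h) shifted ReLUs. A layer of width one carries the inner sum s to the grid of f_0:
   on the cube |s| <= S, so s can be replaced by its truncation ReLU (s + S) - S. This bottleneck
   keeps the number of parameters linear in 1/eps, because the two grids are not fully connected
   to each other. The factor sqrt d compares the l1 norm with the Euclidean norm. *)
theory Submission
  imports Defs
begin

no_notation vec_nth (infixl "$" 90)

section \<open>Piecewise linear interpolation by ReLUs\<close>

lemma ReLU_mono: "x \<le> y \<Longrightarrow> ReLU x \<le> ReLU y"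
  by (simp add: ReLU_def)

lemma ReLU_contraction: "\<bar>ReLU x - ReLU y\<bar> \<le> \<bar>x - y\<bar>"
  by (simp add: ReLU_def)

text \<open>Collects the coefficients of equal breakpoints: \<open>w k\<close> is the change of
  slope at \<open>t k\<close>, with slope 0 before the first and after the last. The ramp form suits
  estimates, the ReLU form is what a layer computes; N ramps cost N + 1 neurons.\<close>

lemma sum_ramps_eq_sum_ReLU:
  "\<exists>w. \<forall>x. (\<Sum>k<N. s k * (ReLU (x - t k) - ReLU (x - t (Suc k)))) = (\<Sum>k\<le>N. w k * ReLU (x - t k))"
proof (induction N)
  case 0
  show ?case by (rule exI[of _ "\<lambda>_. 0"]) simp
next
  case (Suc N)
  then obtain w where w:
    "\<And>x. (\<Sum>k<N. s k * (ReLU (x - t k) - ReLU (x - t (Suc k)))) = (\<Sum>k\<le>N. w k * ReLU (x - t k))"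
    by blast
  \<comment> \<open>The new ramp switches the slope \<open>s N\<close> on at \<open>t N\<close> and
    off again at \<open>t (Suc N)\<close>.\<close>
  define v where "v = w(N := w N + s N, Suc N := - s N)"
  have "(\<Sum>k<Suc N. s k * (ReLU (x - t k) - ReLU (x - t (Suc k)))) = (\<Sum>k\<le>Suc N. v k * ReLU (x - t k))"
    for x
  proof -
    have "(\<Sum>k<N. v k * ReLU (x - t k)) = (\<Sum>k<N. w k * ReLU (x - t k))"
      by (rule sum.cong) (auto simp: v_def)
    moreover have "(\<Sum>k\<le>n. g k) = (\<Sum>k<n. g k) + g n" for n and g :: "nat \<Rightarrow> real"
      by (simp add: lessThan_Suc_atMost[symmetric])
    ultimately show ?thesis
      using w[of x] by (simp add: v_def algebra_simps)
  qed
  then show ?case by blast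
qed

lemma ramp_mono:
  assumes "x \<le> y" and "a \<le> b"
  shows "ReLU (x - a) - ReLU (x - b) \<le> ReLU (y - a) - ReLU (y - b)"
  using assms by (simp add: ReLU_def)

text \<open>Adding the Lipschitz constants of the ramps would give N * K. Instead, all ramps are
  nondecreasing, so their increments can be added without absolute values; the unweighted sum
  telescopes to one long ramp, whose increment is at most \<open>\<bar>x - y\<bar>\<close>.\<close>

lemma ramp_sum_lipschitz:
  fixes t s :: "nat \<Rightarrow> real"
  assumes mono: "\<And>k. t k \<le> t (Suc k)" and s: "\<And>k. \<bar>s k\<bar> \<le> K"
  shows "\<bar>(\<Sum>k<N. s k * (ReLU (x - t k) - ReLU (x - t (Suc k)))) -
          (\<Sum>k<N. s k * (ReLU (y - t k) - ReLU (y - t (Suc k))))\<bar> \<le> K * \<bar>x - y\<bar>"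
proof (induction x y rule: linorder_wlog)
  case (le x y)
  define c where "c k z = ReLU (z - t k) - ReLU (z - t (Suc k))" for k z
  have K: "0 \<le> K" using s[of 0] by linarith
  have "\<bar>(\<Sum>k<N. s k * c k x) - (\<Sum>k<N. s k * c k y)\<bar> = \<bar>\<Sum>k<N. s k * (c k x - c k y)\<bar>"
    by (simp add: sum_subtractf algebra_simps)
  also have "\<dots> \<le> (\<Sum>k<N. \<bar>s k * (c k x - c k y)\<bar>)"
    by (rule sum_abs)
  also have "\<dots> \<le> (\<Sum>k<N. K * (c k y - c k x))"
  proof (rule sum_mono)
    fix k
    have "c k x \<le> c k y" unfolding c_def by (rule ramp_mono[OF le mono])
    then have "\<bar>c k x - c k y\<bar> = c k y - c k x" by simp
    then show "\<bar>s k * (c k x - c k y)\<bar> \<le> K * (c k y - c k x)"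
      using s[of k] \<open>c k x \<le> c k y\<close> by (simp add: abs_mult mult_right_mono)
  qed
  also have "\<dots> = K * ((\<Sum>k<N. c k y) - (\<Sum>k<N. c k x))"
    by (simp add: sum_distrib_left[symmetric] sum_subtractf)
  also have "\<dots> = K * ((ReLU (y - t 0) - ReLU (y - t N)) - (ReLU (x - t 0) - ReLU (x - t N)))"
    unfolding c_def
    using sum_lessThan_telescope'[of "\<lambda>k. ReLU (x - t k)" N]
      sum_lessThan_telescope'[of "\<lambda>k. ReLU (y - t k)" N] by simp
  also have "\<dots> \<le> K * \<bar>x - y\<bar>"
  proof (rule mult_left_mono[OF _ K])
    \<comment> \<open>The ReLU at \<open>t N\<close> enters the long ramp with a minus sign, so by
      monotonicity it only lowers the increment.\<close>
    have "ReLU (x - t N) \<le> ReLU (y - t N)" using le by (intro ReLU_mono) simp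
    moreover have "\<bar>ReLU (y - t 0) - ReLU (x - t 0)\<bar> \<le> \<bar>x - y\<bar>"
      using ReLU_contraction[of "y - t 0" "x - t 0"] by simp
    ultimately show "ReLU (y - t 0) - ReLU (y - t N) - (ReLU (x - t 0) - ReLU (x - t N)) \<le> \<bar>x - y\<bar>"
      by linarith
  qed
  finally show ?case by (simp add: c_def)
next
  case (sym x y)
  then show ?case by (simp add: abs_minus_commute)
qed

text \<open>The slopes are difference quotients of f, hence bounded by K, and the ramp estimate
  gives the Lipschitz constant. The error is bounded by moving to a grid node at distance at most h,
  where both functions agree: each of them changes by at most K * h.\<close>

lemma ReLU_interpolation:
  fixes f :: "real \<Rightarrow> real" and N :: nat
  assumes f: "K-lipschitz_on UNIV f" and h: "0 < h" and N: "2 * A \<le> real N * h"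
  shows "\<exists>w :: nat \<Rightarrow> real. K-lipschitz_on UNIV (\<lambda>x. f (- A) + (\<Sum>k\<le>N. w k * ReLU (x - (real k * h - A)))) \<and>
    (\<forall>x. \<bar>x\<bar> \<le> A \<longrightarrow>
      \<bar>f (- A) + (\<Sum>k\<le>N. w k * ReLU (x - (real k * h - A))) - f x\<bar> \<le> 2 * K * h)"
proof -
  define t where "t k = real k * h - A" for k
  define s where "s k = (f (t (Suc k)) - f (t k)) / h" for k
  define p where "p x = f (- A) + (\<Sum>k<N. s k * (ReLU (x - t k) - ReLU (x - t (Suc k))))" for x
  have K: "0 \<le> K" using f by (rule lipschitz_on_nonneg)
  have flip: "\<bar>f x - f y\<bar> \<le> K * \<bar>x - y\<bar>" for x y
    using lipschitz_onD[OF f, of x y] by (simp add: dist_real_def)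
  have step: "t (Suc k) = t k + h" for k by (simp add: t_def algebra_simps)
  have tmono: "t j \<le> t k" if "j \<le> k" for j k
    using that h by (simp add: t_def)
  have "\<bar>s k\<bar> \<le> K" for k
    using flip[of "t (Suc k)" "t k"] h by (simp add: s_def step divide_simps)
  then have plip: "\<bar>p x - p y\<bar> \<le> K * \<bar>x - y\<bar>" for x y
    using ramp_sum_lipschitz[where t = t and s = s and K = K and x = x and y = y and N = N] h by (simp add: p_def step)
  \<comment> \<open>At \<open>t j\<close> the ramps with k < j are complete and contribute the full
    increment of f over their cell, the others have not begun; the increments telescope.\<close>
  have node: "p (t j) = f (t j)" if "j \<le> N" for j
  proof -
    have "(\<Sum>k<N. s k * (ReLU (t j - t k) - ReLU (t j - t (Suc k)))) =
          (\<Sum>k<N. if k < j then f (t (Suc k)) - f (t k) else 0)"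
    proof (rule sum.cong)
      fix k
      show "s k * (ReLU (t j - t k) - ReLU (t j - t (Suc k))) =
            (if k < j then f (t (Suc k)) - f (t k) else 0)"
      proof (cases "k < j")
        case True
        then have "t (Suc k) \<le> t j" by (intro tmono) simp
        then show ?thesis using True h by (simp add: ReLU_def step s_def)
      next
        case False
        then have "t j \<le> t k" by (intro tmono) simp
        then show ?thesis using False h by (simp add: ReLU_def step)
      qed
    qed simp
    also have "\<dots> = (\<Sum>k<j. f (t (Suc k)) - f (t k))"
      using that by (intro sum.mono_neutral_cong_right) auto
    also have "\<dots> = f (t j) - f (t 0)"
      by (rule sum_lessThan_telescope)
    finally show ?thesis by (simp add: p_def t_def)
  qed
  have err: "\<bar>p x - f x\<bar> \<le> 2 * K * h" if x: "\<bar>x\<bar> \<le> A" for x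
  proof -
    \<comment> \<open>\<open>t j\<close> is the last node not exceeding x; the hypothesis on N keeps
      it on the grid even for x = A.\<close>
    define j where "j = nat \<lfloor>(x + A) / h\<rfloor>"
    have nn: "0 \<le> (x + A) / h" using x h by simp
    then have j: "real j \<le> (x + A) / h" "(x + A) / h < real j + 1"
      unfolding j_def by linarith+
    have "(x + A) / h \<le> real N"
      using x N h by (simp add: divide_simps)
    with j(1) have "j \<le> N" by linarith
    have "\<bar>x - t j\<bar> \<le> h"
      using j h by (simp add: t_def divide_simps algebra_simps)
    then have "K * \<bar>x - t j\<bar> \<le> K * h" "K * \<bar>t j - x\<bar> \<le> K * h"
      using K by (simp_all add: mult_left_mono abs_minus_commute)
    then show ?thesis
      using plip[of x "t j"] flip[of "t j" x] node[OF \<open>j \<le> N\<close>] by linarith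
  qed
  obtain w where "\<And>x. (\<Sum>k<N. s k * (ReLU (x - t k) - ReLU (x - t (Suc k)))) = (\<Sum>k\<le>N. w k * ReLU (x - t k))"
    using sum_ramps_eq_sum_ReLU[where N = N and s = s and t = t] by blast
  then have p: "p = (\<lambda>x. f (- A) + (\<Sum>k\<le>N. w k * ReLU (x - (real k * h - A))))"
    by (simp add: p_def t_def fun_eq_iff)
  have "K-lipschitz_on UNIV p"
    using plip K by (intro lipschitz_onI) (simp_all add: dist_real_def)
  with err show ?thesis unfolding p by blast
qed

section \<open>Lipschitz maps between Euclidean spaces\<close>

lemma lipschitz_map_imp_continuous_maps:
  assumes "lipschitz_map L m n F"
  shows "F \<in> continuous_maps m n"
proof -
  interpret M: Metric_space12 "carrier_vec m" "eucl_dist m" "carrier_vec n" "eucl_dist n"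
    by (intro Metric_space12.intro Metric_space_eucl)
  have "\<exists>\<delta>>0. \<forall>y. y \<in> carrier_vec m \<and> eucl_dist m x y < \<delta> \<longrightarrow> eucl_dist n (F x) (F y) < e"
    if x: "x \<in> carrier_vec m" and e: "0 < e" for x e
  proof (intro exI conjI allI impI)
    have L: "0 \<le> L" using assms by (simp add: lipschitz_map_def)
    \<comment> \<open>Dividing by L + 1 rather than L covers the case L = 0.\<close>
    then show "0 < e / (L + 1)" using e by simp
    fix y assume "y \<in> carrier_vec m \<and> eucl_dist m x y < e / (L + 1)"
    then have y: "y \<in> carrier_vec m" and d: "eucl_dist m x y < e / (L + 1)" by auto
    have "eucl_dist n (F x) (F y) \<le> L * eucl_dist m x y"
      using assms x y by (simp add: lipschitz_map_def)
    also have "\<dots> \<le> (L + 1) * eucl_dist m x y"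
      by (simp add: algebra_simps)
    also have "\<dots> < e"
      using d L by (simp add: field_simps)
    finally show "eucl_dist n (F x) (F y) < e" .
  qed
  moreover have "F ` carrier_vec m \<subseteq> carrier_vec n"
    using assms by (auto simp: lipschitz_map_def)
  ultimately show ?thesis
    unfolding continuous_maps_def eucl_topology_def
    by (auto simp: M.M1.metric_continuous_map[OF M.M2.Metric_space_axioms])
qed

lemma eucl_dist_1: "eucl_dist 1 x y = \<bar>x $ 0 - y $ 0\<bar>"
  by (simp add: eucl_dist_def L2_set_def lessThan_Suc)

text \<open>Cauchy-Schwarz against the all-ones vector, whose norm is
  \<open>sqrt (real d)\<close>.\<close>

lemma sum_abs_le_sqrt_eucl_dist:
  "(\<Sum>i<d. \<bar>x $ i - y $ i\<bar>) \<le> sqrt (real d) * eucl_dist d x y"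
  using L2_set_mult_ineq[of "\<lambda>_. 1" "\<lambda>i. x $ i - y $ i" "{..<d}"]
  by (simp add: L2_set_def eucl_dist_def)

text \<open>One factor K comes from the outer function and one from the summands. It is meant for
  the network itself, with the interpolants as \<open>p i\<close>, so the bound holds on the whole
  space and not only on the cube.\<close>

lemma lipschitz_map_additive:
  fixes F :: "real vec \<Rightarrow> real vec" and p :: "nat \<Rightarrow> real \<Rightarrow> real"
  assumes g: "K-lipschitz_on UNIV g" and p: "\<And>i. K-lipschitz_on UNIV (p i)"
    and F: "F \<in> carrier_vec d \<rightarrow> carrier_vec 1"
    and F_eq: "\<And>x. x \<in> carrier_vec d \<Longrightarrow> F x $ 0 = g (\<Sum>i<d. p i (x $ i))"
  shows "lipschitz_map (sqrt (real d) * K\<^sup>2) d 1 F"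
  unfolding lipschitz_map_def
proof (intro conjI ballI)
  have K: "0 \<le> K" using g by (rule lipschitz_on_nonneg)
  show "0 \<le> sqrt (real d) * K\<^sup>2" by simp
  fix x y :: "real vec" assume xy: "x \<in> carrier_vec d" "y \<in> carrier_vec d"
  have "eucl_dist 1 (F x) (F y) = \<bar>g (\<Sum>i<d. p i (x $ i)) - g (\<Sum>i<d. p i (y $ i))\<bar>"
    using xy by (simp add: eucl_dist_1[unfolded One_nat_def] F_eq)
  also have "\<dots> \<le> K * \<bar>(\<Sum>i<d. p i (x $ i)) - (\<Sum>i<d. p i (y $ i))\<bar>"
    using lipschitz_onD[OF g] by (simp add: dist_real_def)
  also have "\<dots> \<le> K * (\<Sum>i<d. \<bar>p i (x $ i) - p i (y $ i)\<bar>)"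
    using K by (intro mult_left_mono) (simp_all flip: sum_subtractf)
  also have "\<dots> \<le> K * (\<Sum>i<d. K * \<bar>x $ i - y $ i\<bar>)"
    using K lipschitz_onD[OF p] by (intro mult_left_mono sum_mono) (simp_all add: dist_real_def)
  also have "\<dots> = K\<^sup>2 * (\<Sum>i<d. \<bar>x $ i - y $ i\<bar>)"
    by (simp add: sum_distrib_left power2_eq_square algebra_simps)
  also have "\<dots> \<le> K\<^sup>2 * (sqrt (real d) * eucl_dist d x y)"
    by (intro mult_left_mono sum_abs_le_sqrt_eucl_dist) simp
  finally show "eucl_dist 1 (F x) (F y) \<le> sqrt (real d) * K\<^sup>2 * eucl_dist d x y"
    by (simp add: algebra_simps)
qed (use F in auto)

section \<open>The network with a bottleneck\<close>

text \<open>Neuron \<open>i * m + k\<close> of the first hidden layer is the \<open>k\<close>-th ReLU, with threshold \<open>t k\<close>, in the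
  variable \<open>x $ i\<close>; the second hidden layer has a single neuron.\<close>

definition bottleneck_net ::
  "nat \<Rightarrow> nat \<Rightarrow> nat \<Rightarrow> (nat \<Rightarrow> real) \<Rightarrow> (nat \<Rightarrow> nat \<Rightarrow> real) \<Rightarrow> real \<Rightarrow>
    (nat \<Rightarrow> real) \<Rightarrow> (nat \<Rightarrow> real) \<Rightarrow> real \<Rightarrow> layers" where
  "bottleneck_net d m n t w c t' w' c' =
    [(mat (d * m) d (\<lambda>(i, j). if j = i div m then 1 else 0), vec (d * m) (\<lambda>i. - t (i mod m))),
     (mat 1 (d * m) (\<lambda>(_, i). w (i div m) (i mod m)), vec 1 (\<lambda>_. c)),
     (mat n 1 (\<lambda>_. 1), vec n (\<lambda>k. - t' k)),
     (mat 1 n (\<lambda>(_, k). w' k), vec 1 (\<lambda>_. c'))]"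

lemma bottleneck_net_skeleton:
  assumes "d \<ge> 1" "m \<ge> 1" "n \<ge> 1"
  shows "bottleneck_net d m n t w c t' w' c' \<in> skeletons"
proof -
  have "k = 0 \<or> k = 1 \<or> k = 2 \<or> k = 3 \<or> k = 4" if "k \<le> 4" for k :: nat
    using that by linarith
  then show ?thesis
    using assms by (fastforce simp: skeletons_def layer_dim_def bottleneck_net_def nth_Cons')
qed

lemma bottleneck_net_layer_dim:
  "layer_dim (bottleneck_net d m n t w c t' w' c') 0 = d"
  "layer_dim (bottleneck_net d m n t w c t' w' c') (length (bottleneck_net d m n t w c t' w' c')) = 1"
  by (simp_all add: layer_dim_def bottleneck_net_def)

text \<open>The four layers contribute d * m * (d + 1), d * m + 1, 2 * n and n + 1. Thanks to the
  layer of width one no product m * n appears.\<close>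

lemma bottleneck_net_num_params:
  "num_params (bottleneck_net d m n t w c t' w' c') = d * m * (d + 2) + 3 * n + 2"
proof -
  have "{1..4::nat} = {1, 2, 3, 4}" by auto
  then show ?thesis
    by (simp add: num_params_def layer_dim_def bottleneck_net_def algebra_simps)
qed

text \<open>The indices split into d blocks of length m; in block i the quotient is i and the
  remainder runs through all k < m. This turns the flat numbering of neurons into pairs of a
  coordinate and a threshold.\<close>

lemma sum_div_mod:
  fixes g :: "nat \<Rightarrow> nat \<Rightarrow> 'a :: comm_monoid_add"
  shows "(\<Sum>i<d * m. g (i div m) (i mod m)) = (\<Sum>i<d. \<Sum>k<m. g i k)"
proof -
  have "(\<Sum>i<d * m. g (i div m) (i mod m)) =
        (\<Sum>i<d. \<Sum>j = i * m..<i * m + m. g (j div m) (j mod m))"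
    by (rule sum.nat_group[symmetric])
  also have "\<dots> = (\<Sum>i<d. \<Sum>k<m. g i k)"
  proof (rule sum.cong)
    fix i
    have "(\<Sum>j = i * m..<i * m + m. g (j div m) (j mod m)) =
          (\<Sum>k = 0..<m. g ((k + i * m) div m) ((k + i * m) mod m))"
      using sum.shift_bounds_nat_ivl[of "\<lambda>j. g (j div m) (j mod m)" 0 "i * m" m]
      by (simp add: add.commute)
    also have "\<dots> = (\<Sum>k<m. g i k)"
      by (auto simp: lessThan_atLeast0 intro!: sum.cong)
    finally show "(\<Sum>j = i * m..<i * m + m. g (j div m) (j mod m)) = (\<Sum>k<m. g i k)" .
  qed simp
  finally show ?thesis .
qed

lemma dim_affine [simp]: "dim_vec (affine A x) = dim_vec (snd A)"
  by (simp add: affine_def)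

lemma bottleneck_net_carrier:
  "realization (bottleneck_net d m n t w c t' w' c') x \<in> carrier_vec 1"
  by (rule carrier_vecI) (simp add: bottleneck_net_def)

text \<open>The ReLU around the double sum is the activation of the single neuron of the second
  hidden layer; it later performs the truncation.\<close>

lemma bottleneck_net_realization:
  assumes x: "x \<in> carrier_vec d"
  shows "realization (bottleneck_net d m n t w c t' w' c') x $ 0 =
    c' + (\<Sum>k<n. w' k * ReLU (ReLU (c + (\<Sum>i<d. \<Sum>k<m. w i k * ReLU (x $ i - t k))) - t' k))"
proof -
  define y1 where "y1 = map_vec ReLU (affine
    (mat (d * m) d (\<lambda>(i, j). if j = i div m then 1 else 0), vec (d * m) (\<lambda>i. - t (i mod m))) x)"
  define y2 where "y2 = map_vec ReLU (affine
    (mat 1 (d * m) (\<lambda>(_, i). w (i div m) (i mod m)), vec 1 (\<lambda>_. c)) y1)"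
  define y3 where "y3 = map_vec ReLU (affine (mat n 1 (\<lambda>_. 1), vec n (\<lambda>k. - t' k)) y2)"
  have dim: "dim_vec y1 = d * m" "dim_vec y2 = 1" "dim_vec y3 = n"
    by (simp_all add: y1_def y2_def y3_def affine_def)
  have y1: "y1 $ i = ReLU (x $ (i div m) - t (i mod m))" if i: "i < d * m" for i
  proof -
    \<comment> \<open>Row i of the first matrix is the unit vector that selects coordinate
      \<open>i div m\<close>.\<close>
    have "i div m < d" using i by (simp add: less_mult_imp_div_less)
    then have "(\<Sum>j = 0..<d. (if j = i div m then 1 else 0) * x $ j) = x $ (i div m)"
      by (simp add: if_distrib[of "\<lambda>a. a * _"] cong: if_cong)
    then show ?thesis
      using i x by (simp add: y1_def affine_def scalar_prod_def)
  qed
  have "y2 $ 0 = ReLU (c + (\<Sum>i<d * m. w (i div m) (i mod m) * ReLU (x $ (i div m) - t (i mod m))))"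
    using dim y1 by (simp add: y2_def affine_def scalar_prod_def lessThan_atLeast0 add.commute)
  then have y2: "y2 $ 0 = ReLU (c + (\<Sum>i<d. \<Sum>k<m. w i k * ReLU (x $ i - t k)))"
    by (simp only: sum_div_mod[of "\<lambda>i k. w i k * ReLU (x $ i - t k)"])
  have y3: "y3 $ k = ReLU (y2 $ 0 - t' k)" if "k < n" for k
    using that dim by (simp add: y3_def affine_def scalar_prod_def)
  have "realization (bottleneck_net d m n t w c t' w' c') x =
      affine (mat 1 n (\<lambda>(_, k). w' k), vec 1 (\<lambda>_. c')) y3"
    by (simp add: bottleneck_net_def y1_def y2_def y3_def)
  also have "\<dots> $ 0 = c' + (\<Sum>k<n. w' k * ReLU (y2 $ 0 - t' k))"
    using dim y3 by (simp add: affine_def scalar_prod_def lessThan_atLeast0 add.commute)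
  finally show ?thesis by (simp only: y2)
qed

section \<open>Parameter count and propagation of the interpolation errors\<close>

lemma bottleneck_param_bound:
  fixes K r \<epsilon> :: real and d M N :: nat
  assumes "K \<ge> 1" "r \<ge> 1" "d \<ge> 1" "0 < \<epsilon>" "\<epsilon> \<le> 1"
    and M: "real M \<le> 8 * r * K\<^sup>2 * real d / \<epsilon> + 2"
    and N: "real N \<le> 16 * r * K\<^sup>2 * real d / \<epsilon> + 2"
  shows "real (d * M * (d + 2) + 3 * N + 2) \<le> 5 / 6 * 10 ^ 3 * K ^ 4 * r * real d ^ 6 * inverse \<epsilon>"
proof -
  \<comment> \<open>Both grid sizes are multiples of X up to additive constants, and X >= 1 absorbs
    these.\<close>
  define X where "X = r * K\<^sup>2 * real d / \<epsilon>"
  define D where "D = real d"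
  have D: "D \<ge> 1" using assms by (simp add: D_def)
  have rK: "1 \<le> r * K\<^sup>2" using assms mult_mono[of 1 r 1 "K\<^sup>2"] by simp
  then have "1 \<le> r * K\<^sup>2 * D" using D mult_mono[of 1 "r * K\<^sup>2" 1 D] by simp
  then have X: "1 \<le> X" using assms by (simp add: X_def D_def divide_simps)
  have M': "real M \<le> 10 * X" and N': "real N \<le> 18 * X"
  proof -
    have eq: "8 * r * K\<^sup>2 * real d / \<epsilon> = 8 * X" "16 * r * K\<^sup>2 * real d / \<epsilon> = 16 * X"
      by (simp_all add: X_def)
    show "real M \<le> 10 * X" "real N \<le> 18 * X"
      using M N X unfolding eq by simp_all
  qed
  have "real (d * M * (d + 2) + 3 * N + 2) = D * real M * (D + 2) + 3 * real N + 2"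
    by (simp add: D_def algebra_simps)
  also have "\<dots> \<le> D * (10 * X) * (3 * D) + 3 * (18 * X) + 2 * X"
    using M' N' X D by (intro add_mono mult_mono) simp_all
  \<comment> \<open>86 = 30 + 54 + 2, using \<open>1 \<le> D\<^sup>2\<close>. The true order is thus
    \<open>K\<^sup>2 * r * D ^ 3 / \<epsilon>\<close>, and the claimed bound follows
    generously.\<close>
  also have "\<dots> \<le> 86 * X * D\<^sup>2"
    using X mult_left_mono[OF one_le_power[OF D, of 2], of X] by (simp add: power2_eq_square algebra_simps)
  also have "\<dots> = 86 * (r * inverse \<epsilon>) * (K\<^sup>2 * D ^ 3)"
    by (simp add: X_def D_def divide_inverse power2_eq_square power3_eq_cube algebra_simps)
  also have "\<dots> \<le> (5 / 6 * 10 ^ 3) * (r * inverse \<epsilon>) * (K ^ 4 * D ^ 6)"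
    using assms D by (intro mult_mono power_increasing) (simp_all add: mult_right_mono)
  finally show ?thesis by (simp add: D_def algebra_simps)
qed

text \<open>The error is split at q(s), where s is the exact inner sum: replacing g by q at s costs
  half of \<open>\<epsilon>\<close>, since s lies where q is accurate; replacing s by the truncated
  approximate sum costs K times the total inner error, the other half.\<close>

lemma bottleneck_approximation:
  fixes K \<epsilon> S :: real and f p :: "nat \<Rightarrow> real \<Rightarrow> real"
  assumes K: "K \<ge> 1" and d: "d \<ge> 1"
    and f_bound: "\<And>i. i < d \<Longrightarrow> \<bar>f i (x i)\<bar> \<le> S / real d"
    and q_lip: "K-lipschitz_on UNIV q" and q: "\<And>z. \<bar>z\<bar> \<le> S \<Longrightarrow> \<bar>q z - g z\<bar> \<le> \<epsilon> / 2"
    and p: "\<And>i. i < d \<Longrightarrow> \<bar>p i (x i) - f i (x i)\<bar> \<le> \<epsilon> / (2 * K * real d)"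
  shows "\<bar>g (\<Sum>i<d. f i (x i)) - q (ReLU (S + (\<Sum>i<d. p i (x i))) - S)\<bar> \<le> \<epsilon>"
proof -
  define s where "s = (\<Sum>i<d. f i (x i))"
  define z where "z = (\<Sum>i<d. p i (x i))"
  have "\<bar>s\<bar> \<le> (\<Sum>i<d. S / real d)"
    unfolding s_def using f_bound by (intro order_trans[OF sum_abs sum_mono]) simp
  then have s: "\<bar>s\<bar> \<le> S" using d by simp
  have "\<bar>z - s\<bar> \<le> (\<Sum>i<d. \<epsilon> / (2 * K * real d))"
    unfolding s_def z_def sum_subtractf[symmetric]
    using p by (intro order_trans[OF sum_abs sum_mono]) simp
  then have z: "\<bar>z - s\<bar> \<le> \<epsilon> / (2 * K)" using d K by (simp add: field_simps)
  \<comment> \<open>The truncation is max z (- S); since s >= - S, it cannot move z away from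
    s.\<close>
  have "\<bar>(ReLU (S + z) - S) - s\<bar> \<le> \<bar>z - s\<bar>"
    using s by (simp add: ReLU_def)
  then have "K * \<bar>(ReLU (S + z) - S) - s\<bar> \<le> K * (\<epsilon> / (2 * K))"
    using z K by (intro mult_left_mono) auto
  also have "\<dots> = \<epsilon> / 2" using K by simp
  finally have "\<bar>q (ReLU (S + z) - S) - q s\<bar> \<le> \<epsilon> / 2"
    using lipschitz_onD[OF q_lip, of "ReLU (S + z) - S" s] by (simp add: dist_real_def)
  with q[OF s] show ?thesis unfolding s_def z_def by linarith
qed

section \<open>Choice of the grids and assembly of the network\<close>

theorem proposition29:
  fixes K r :: real and f :: "nat \<Rightarrow> real \<Rightarrow> real"
  assumes "K \<ge> 1" and "r \<ge> 1"
    and "\<And>i. K-lipschitz_on UNIV (f i)"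
    and "\<And>i. \<bar>f i 0\<bar> \<le> K"
  shows "\<forall>d::nat. \<forall>\<epsilon>::real. d \<ge> 1 \<and> 0 < \<epsilon> \<and> \<epsilon> \<le> 1 \<longrightarrow>
    (\<exists>\<phi>\<in>skeletons.
       layer_dim \<phi> 0 = d \<and> layer_dim \<phi> (length \<phi>) = 1 \<and>
       realization \<phi> \<in> continuous_maps d 1 \<and>
       (SUP x\<in>cube d r. ereal \<bar>gfun f d x - realization \<phi> x $ 0\<bar>) \<le> ereal \<epsilon> \<and>
       lipschitz_map (sqrt (real d) * K\<^sup>2) d 1 (realization \<phi>) \<and>
       real (num_params \<phi>) \<le> 5 / 6 * 10 ^ 3 * K ^ 4 * r * real d ^ 6 * inverse \<epsilon>)"
proof (intro allI impI)
  fix d :: nat and \<epsilon> :: real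
  assume "d \<ge> 1 \<and> 0 < \<epsilon> \<and> \<epsilon> \<le> 1"
  then have d: "d \<ge> 1" and \<epsilon>: "0 < \<epsilon>" "\<epsilon> \<le> 1" by auto
  note K = assms(1) and r = assms(2) and lip = assms(3)
  \<comment> \<open>Each summand is at most K * r + K <= 2 * K * r on the cube, and there are d of
    them.\<close>
  define S where "S = 2 * K * r * real d"
  \<comment> \<open>With these steps \<open>2 * K * h = \<epsilon> / (2 * K * d)\<close> and
    \<open>2 * K * h' = \<epsilon> / 2\<close>: the d inner errors, amplified by K, and the outer
    error each use half of \<open>\<epsilon>\<close>.\<close>
  define h where "h = \<epsilon> / (4 * K\<^sup>2 * real d)"
  define h' where "h' = \<epsilon> / (4 * K)"
  \<comment> \<open>The numbers of cells are 2 * r / h and 2 * S / h', rounded up.\<close>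
  define M where "M = nat \<lceil>8 * r * K\<^sup>2 * real d / \<epsilon>\<rceil>"
  define N where "N = nat \<lceil>16 * r * K\<^sup>2 * real d / \<epsilon>\<rceil>"
  have h: "0 < h" "0 < h'" using K d \<epsilon> by (simp_all add: h_def h'_def)
  have Mge: "8 * r * K\<^sup>2 * real d / \<epsilon> \<le> real M" and Nge: "16 * r * K\<^sup>2 * real d / \<epsilon> \<le> real N"
    unfolding M_def N_def by (rule real_nat_ceiling_ge)+
  have nn: "0 \<le> 8 * r * K\<^sup>2 * real d / \<epsilon>" "0 \<le> 16 * r * K\<^sup>2 * real d / \<epsilon>"
    using r \<epsilon> by simp_all
  \<comment> \<open>The summand 2 pays for the rounding and for the one breakpoint more than there
    are cells.\<close>
  then have Mle: "real (Suc M) \<le> 8 * r * K\<^sup>2 * real d / \<epsilon> + 2"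
    and Nle: "real (Suc N) \<le> 16 * r * K\<^sup>2 * real d / \<epsilon> + 2"
    unfolding M_def N_def by linarith+
  have "8 * r * K\<^sup>2 * real d / \<epsilon> * h = 2 * r"
    using K d \<epsilon> by (simp add: h_def)
  then have Mh: "2 * r \<le> real M * h"
    using mult_right_mono[OF Mge, of h] h by simp
  have "16 * r * K\<^sup>2 * real d / \<epsilon> * h' = 2 * S"
    using K d \<epsilon> by (simp add: h'_def S_def power2_eq_square)
  then have Nh: "2 * S \<le> real N * h'"
    using mult_right_mono[OF Nge, of h'] h by simp
  have "\<forall>i. \<exists>w :: nat \<Rightarrow> real. K-lipschitz_on UNIV
      (\<lambda>x. f (Suc i) (- r) + (\<Sum>k\<le>M. w k * ReLU (x - (real k * h - r)))) \<and>
    (\<forall>x. \<bar>x\<bar> \<le> r \<longrightarrow>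
      \<bar>f (Suc i) (- r) + (\<Sum>k\<le>M. w k * ReLU (x - (real k * h - r))) - f (Suc i) x\<bar> \<le> 2 * K * h)"
    by (intro allI ReLU_interpolation lip h Mh)
  from choice[OF this] obtain w where w: "\<forall>i. K-lipschitz_on UNIV
      (\<lambda>x. f (Suc i) (- r) + (\<Sum>k\<le>M. w i k * ReLU (x - (real k * h - r)))) \<and>
    (\<forall>x. \<bar>x\<bar> \<le> r \<longrightarrow>
      \<bar>f (Suc i) (- r) + (\<Sum>k\<le>M. w i k * ReLU (x - (real k * h - r))) - f (Suc i) x\<bar> \<le> 2 * K * h)"
    by (elim exE)
  \<comment> \<open>The shift to \<open>Suc i\<close> matches the vector index i, counted from 0,
    with the inner functions, counted from 1.\<close>
  define p where "p i x = f (Suc i) (- r) + (\<Sum>k<Suc M. w i k * ReLU (x - (real k * h - r)))" for i x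
  have p_lip: "K-lipschitz_on UNIV (p i)" for i
    using w unfolding p_def[abs_def] lessThan_Suc_atMost by blast
  have p_err: "\<bar>p i x - f (Suc i) x\<bar> \<le> 2 * K * h" if "\<bar>x\<bar> \<le> r" for i x
    using w that unfolding p_def lessThan_Suc_atMost by blast
  obtain w' where w': "K-lipschitz_on UNIV
      (\<lambda>x. f 0 (- S) + (\<Sum>k\<le>N. w' k * ReLU (x - (real k * h' - S))))"
    "\<forall>x. \<bar>x\<bar> \<le> S \<longrightarrow>
      \<bar>f 0 (- S) + (\<Sum>k\<le>N. w' k * ReLU (x - (real k * h' - S))) - f 0 x\<bar> \<le> 2 * K * h'"
    using ReLU_interpolation[OF lip[of 0] h(2) Nh] by (elim exE conjE)
  define q where "q x = f 0 (- S) + (\<Sum>k<Suc N. w' k * ReLU (x - (real k * h' - S)))" for x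
  have q_lip: "K-lipschitz_on UNIV q"
    using w' unfolding q_def[abs_def] lessThan_Suc_atMost by blast
  have q_err: "\<bar>q x - f 0 x\<bar> \<le> 2 * K * h'" if "\<bar>x\<bar> \<le> S" for x
    using w' that unfolding q_def lessThan_Suc_atMost by blast
  \<comment> \<open>The bias of the bottleneck gathers S and the left boundary values of all inner
    interpolants. As this neuron carries the sum shifted by S, the outer thresholds are k * h'
    instead of k * h' - S.\<close>
  define \<phi> where "\<phi> = bottleneck_net d (Suc M) (Suc N) (\<lambda>k. real k * h - r) w
    (S + (\<Sum>i<d. f (Suc i) (- r))) (\<lambda>k. real k * h') w' (f 0 (- S))"
  have real_eq: "realization \<phi> x $ 0 = q (ReLU (S + (\<Sum>i<d. p i (x $ i))) - S)"
    if "x \<in> carrier_vec d" for x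
  proof -
    have sum_eq: "S + (\<Sum>i<d. f (Suc i) (- r)) + (\<Sum>i<d. \<Sum>k<Suc M. w i k * ReLU (x $ i - (real k * h - r)))
        = S + (\<Sum>i<d. p i (x $ i))"
      by (simp only: p_def sum.distrib add.assoc)
    show ?thesis
      unfolding \<phi>_def bottleneck_net_realization[OF that] sum_eq q_def by simp
  qed
  \<comment> \<open>The outer function of the network is q after the truncation, which as a
    contraction leaves the constant K unchanged.\<close>
  have "K-lipschitz_on UNIV (\<lambda>z. q (ReLU (S + z) - S))"
  proof (rule lipschitz_onI)
    show "0 \<le> K" using K by simp
    fix y z
    have "dist (q (ReLU (S + y) - S)) (q (ReLU (S + z) - S)) \<le> K * \<bar>ReLU (S + y) - ReLU (S + z)\<bar>"
      using lipschitz_onD[OF q_lip, of "ReLU (S + y) - S" "ReLU (S + z) - S"]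
      by (simp add: dist_real_def)
    also have "\<dots> \<le> K * \<bar>y - z\<bar>"
      using ReLU_contraction[of "S + y" "S + z"] K by (intro mult_left_mono) simp_all
    finally show "dist (q (ReLU (S + y) - S)) (q (ReLU (S + z) - S)) \<le> K * dist y z"
      by (simp add: dist_real_def)
  qed
  then have lipschitz: "lipschitz_map (sqrt (real d) * K\<^sup>2) d 1 (realization \<phi>)"
    by (rule lipschitz_map_additive[where p = p, OF _ p_lip])
      (simp_all only: real_eq, simp add: \<phi>_def bottleneck_net_carrier[unfolded One_nat_def])
  have approx: "\<bar>gfun f d x - realization \<phi> x $ 0\<bar> \<le> \<epsilon>" if "x \<in> cube d r" for x
  proof -
    have x: "x \<in> carrier_vec d" and xr: "\<And>i. i < d \<Longrightarrow> \<bar>x $ i\<bar> \<le> r"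
      using that by (auto simp: cube_def abs_le_iff minus_le_iff)
    have f_bound: "\<bar>f (Suc i) (x $ i)\<bar> \<le> S / real d" if "i < d" for i
    proof -
      have "\<bar>f (Suc i) (x $ i) - f (Suc i) 0\<bar> \<le> K * \<bar>x $ i\<bar>"
        using lipschitz_onD[OF lip, of "x $ i" 0] by (simp add: dist_real_def)
      also have "\<dots> \<le> K * r"
        using xr[OF that] K by (intro mult_left_mono) auto
      finally have "\<bar>f (Suc i) (x $ i)\<bar> \<le> K * r + K"
        using assms(4)[of "Suc i"] by linarith
      also have "\<dots> \<le> K * r + K * r"
        using K r by simp
      also have "\<dots> = S / real d" using d by (simp add: S_def)
      finally show ?thesis .
    qed
    have "2 * K * h = \<epsilon> / (2 * K * real d)"
      using K d by (simp add: h_def power2_eq_square field_simps)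
    then have p_err': "\<bar>p i (x $ i) - f (Suc i) (x $ i)\<bar> \<le> \<epsilon> / (2 * K * real d)" if "i < d" for i
      using p_err[OF xr[OF that], of i] by simp
    have q_err': "\<bar>q z - f 0 z\<bar> \<le> \<epsilon> / 2" if "\<bar>z\<bar> \<le> S" for z
      using q_err[OF that] K by (simp add: h'_def)
    have "gfun f d x = f 0 (\<Sum>i<d. f (Suc i) (x $ i))"
      using sum.atLeast1_atMost_eq[of "\<lambda>i. f i (x $ (i - 1))" d] by (simp add: gfun_def)
    then show ?thesis
      using bottleneck_approximation[of K d "\<lambda>i. f (Suc i)" "\<lambda>i. x $ i" S q "f 0" \<epsilon> p,
          OF K d f_bound q_lip q_err' p_err']
      by (simp add: real_eq[OF x])
  qed
  show "\<exists>\<phi>\<in>skeletons.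
       layer_dim \<phi> 0 = d \<and> layer_dim \<phi> (length \<phi>) = 1 \<and>
       realization \<phi> \<in> continuous_maps d 1 \<and>
       (SUP x\<in>cube d r. ereal \<bar>gfun f d x - realization \<phi> x $ 0\<bar>) \<le> ereal \<epsilon> \<and>
       lipschitz_map (sqrt (real d) * K\<^sup>2) d 1 (realization \<phi>) \<and>
       real (num_params \<phi>) \<le> 5 / 6 * 10 ^ 3 * K ^ 4 * r * real d ^ 6 * inverse \<epsilon>"
  proof (intro bexI[of _ \<phi>] conjI)
    show "\<phi> \<in> skeletons"
      using d unfolding \<phi>_def by (intro bottleneck_net_skeleton) simp_all
    show "layer_dim \<phi> 0 = d" "layer_dim \<phi> (length \<phi>) = 1"
      unfolding \<phi>_def by (rule bottleneck_net_layer_dim)+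
    show "realization \<phi> \<in> continuous_maps d 1"
      using lipschitz by (rule lipschitz_map_imp_continuous_maps)
    show "(SUP x\<in>cube d r. ereal \<bar>gfun f d x - realization \<phi> x $ 0\<bar>) \<le> ereal \<epsilon>"
      using approx by (intro SUP_least) simp
    show "real (num_params \<phi>) \<le> 5 / 6 * 10 ^ 3 * K ^ 4 * r * real d ^ 6 * inverse \<epsilon>"
      unfolding \<phi>_def bottleneck_net_num_params
      by (rule bottleneck_param_bound[OF K r d \<epsilon> Mle Nle])
  qed (rule lipschitz)
qed

end
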